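(* Let $(G,u,c,B)$ be an instance of (BMFNI) with $G$ a two-terminal parallel graph with arcs $a_1,\dots,a_m$ and capacities $(u^1(a),u^2(a))$ for every arc $a$. Let $X_E$ denote the set of efficient solutions of the biobjective maximization problem $$\max\Big\{v(x):=\Big(\sum_{i=1}^m u^1(a_i)x_i,\ \sum_{i=1}^m u^2(a_i)x_i\Big)\ \Big|\ \sum_{i=1}^m c(a_i)x_i\leq B,\ x\in\{0,1\}^m\Big\}.$$ Then $X_E=\Gamma_E$, where $\Gamma_E$ is the set of efficient interdiction strategies of the (BMFNI) instance.
   Context: $\mathbb{N}$ includes $0$. Graphs are directed and parallel arcs are allowed. An instance $(G,u,c,B)$ of the biobjective maximum flow network interdiction problem (BMFNI) consists of a directed graph $G=(V,A)$ with $m=|A|$ arcs, a source $s\in V$ and a sink $t\in V$, $s\neq t$, two arc capacity functions $u=(u^1,u^2)\colon A\to\mathbb{N}^2$, interdiction costs $c(a)\in\mathbb{N}$ for $a\in A$, and an interdiction budget $B\in\mathbb{N}$. The set of feasible interdiction strategies is $\Gamma=\{\gamma=(\gamma_a)_{a\in A}\in\{0,1\}^m \mid \sum_{a\in A}c(a)\gamma_a\leq B\}$. For $\gamma\in\Gamma$, let $A(\gamma)=\{a\in A\mid\gamma_a=1\}$ be the set of interdicted arcs and $G(\gamma)=(V,A\setminus A(\gamma))$ the interdicted graph. For a capacity function $w$, $\mathrm{VAL}(G(\gamma),w)$ is the maximum value of an $s$-$t$-flow in $G(\gamma)$ with respect to the capacities $w$, and $\mathrm{VAL}(G(\gamma),u)=(\mathrm{VAL}(G(\gamma),u^1),\mathrm{VAL}(G(\gamma),u^2))$.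 For $y,z\in\mathbb{N}^2$, $y\leq z$ means $y_k\leq z_k$ for $k=1,2$ and $y\neq z$. A strategy $\gamma\in\Gamma$ is efficient if there is no $\gamma'\in\Gamma$ with $\mathrm{VAL}(G(\gamma'),u)\leq\mathrm{VAL}(G(\gamma),u)$; $\Gamma_E$ is the set of efficient strategies. For the maximization problem, a feasible $x$ is efficient if there is no feasible $x'$ with $v(x)\leq v(x')$ (in the same order). A two-terminal parallel graph is a directed graph with vertex set $V=\{s,t\}$ whose $m$ arcs are all parallel arcs from $s$ to $t$. Vectors in $\{0,1\}^m$ indexed by $i=1,\dots,m$ and by the arcs are identified via $x_i=x_{a_i}$. *)

theory Defs
  imports Complex_Main "HOL-Library.FuncSet" "Graph_Theory.Digraph"
begin

section \<open>Networks and maximum flows\<close>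

locale st_network = fin_digraph G for G :: "('v, 'e) pre_digraph" (structure) +
  fixes s t :: 'v
  assumes source_in_verts: "s \<in> verts G"
    and sink_in_verts: "t \<in> verts G"
    and source_neq_sink: "s \<noteq> t"

definition two_terminal_parallel :: "('v, 'e) pre_digraph \<Rightarrow> 'v \<Rightarrow> 'v \<Rightarrow> bool" where
  "two_terminal_parallel G s t \<longleftrightarrow>
     verts G = {s, t} \<and> (\<forall>a \<in> arcs G. tail G a = s \<and> head G a = t)"

definition is_flow ::
  "('v, 'e) pre_digraph \<Rightarrow> 'v \<Rightarrow> 'v \<Rightarrow> ('e \<Rightarrow> nat) \<Rightarrow> ('e \<Rightarrow> real) \<Rightarrow> bool" where
  "is_flow G s t w f \<longleftrightarrow>
     (\<forall>a \<in> arcs G. 0 \<le> f a \<and> f a \<le> real (w a)) \<and>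
     (\<forall>v \<in> verts G - {s, t}. (\<Sum>a \<in> in_arcs G v. f a) = (\<Sum>a \<in> out_arcs G v. f a))"

definition flow_value :: "('v, 'e) pre_digraph \<Rightarrow> 'v \<Rightarrow> ('e \<Rightarrow> real) \<Rightarrow> real" where
  "flow_value G s f = (\<Sum>a \<in> out_arcs G s. f a) - (\<Sum>a \<in> in_arcs G s. f a)"

definition max_flow_value ::
  "('v, 'e) pre_digraph \<Rightarrow> 'v \<Rightarrow> 'v \<Rightarrow> ('e \<Rightarrow> nat) \<Rightarrow> real" where
  "max_flow_value G s t w = (GREATEST r. \<exists>f. is_flow G s t w f \<and> r = flow_value G s f)"

definition max_flow_value2 ::
  "('v, 'e) pre_digraph \<Rightarrow> 'v \<Rightarrow> 'v \<Rightarrow> ('e \<Rightarrow> nat \<times> nat) \<Rightarrow> real \<times> real" where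
  "max_flow_value2 G s t u =
     (max_flow_value G s t (\<lambda>a. fst (u a)), max_flow_value G s t (\<lambda>a. snd (u a)))"


section \<open>Efficient solutions\<close>

text \<open>
  Componentwise order without equality. It is polymorphic because values of real-valued
  flows are real numbers (for natural capacities, the maximum values are natural numbers).
\<close>

definition dom_le :: "'a::order \<times> 'a \<Rightarrow> 'a \<times> 'a \<Rightarrow> bool" (infix \<open>\<preceq>\<close> 50) where
  "y \<preceq> z \<longleftrightarrow> fst y \<le> fst z \<and> snd y \<le> snd z \<and> y \<noteq> z"

definition efficient_min :: "'x set \<Rightarrow> ('x \<Rightarrow> 'a::order \<times> 'a) \<Rightarrow> 'x set" where
  "efficient_min S f = {x \<in> S. \<not> (\<exists>x' \<in> S. f x' \<preceq> f x)}"

definition efficient_max :: "'x set \<Rightarrow> ('x \<Rightarrow> 'a::order \<times> 'a) \<Rightarrow> 'x set" where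
  "efficient_max S f = {x \<in> S. \<not> (\<exists>x' \<in> S. f x \<preceq> f x')}"


section \<open>Interdiction\<close>

text \<open>
  Vectors in \<open>{0,1}^I\<close> are extensional functions on \<open>I\<close>, so that they are determined by
  their components and equality of sets of vectors is meaningful.
\<close>

definition strategies :: "('v, 'e) pre_digraph \<Rightarrow> ('e \<Rightarrow> nat) \<Rightarrow> nat \<Rightarrow> ('e \<Rightarrow> nat) set" where
  "strategies G c B = {\<gamma> \<in> arcs G \<rightarrow>\<^sub>E {0, 1}. (\<Sum>a \<in> arcs G. c a * \<gamma> a) \<le> B}"

definition interdicted_arcs :: "('v, 'e) pre_digraph \<Rightarrow> ('e \<Rightarrow> nat) \<Rightarrow> 'e set" where
  "interdicted_arcs G \<gamma> = {a \<in> arcs G. \<gamma> a = 1}"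

definition interdict ::
  "('v, 'e) pre_digraph \<Rightarrow> ('e \<Rightarrow> nat) \<Rightarrow> ('v, 'e) pre_digraph" where
  "interdict G \<gamma> = G\<lparr>arcs := arcs G - interdicted_arcs G \<gamma>\<rparr>"

definition efficient_strategies ::
  "('v, 'e) pre_digraph \<Rightarrow> 'v \<Rightarrow> 'v \<Rightarrow> ('e \<Rightarrow> nat \<times> nat) \<Rightarrow> ('e \<Rightarrow> nat) \<Rightarrow> nat \<Rightarrow> ('e \<Rightarrow> nat) set"
  where
  "efficient_strategies G s t u c B =
     efficient_min (strategies G c B) (\<lambda>\<gamma>. max_flow_value2 (interdict G \<gamma>) s t u)"


section \<open>Biobjective knapsack\<close>

definition knapsack_feasible :: "nat \<Rightarrow> (nat \<Rightarrow> nat) \<Rightarrow> nat \<Rightarrow> (nat \<Rightarrow> nat) set" where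
  "knapsack_feasible m c B = {x \<in> {1..m} \<rightarrow>\<^sub>E {0, 1}. (\<Sum>i = 1..m. c i * x i) \<le> B}"

definition knapsack_value ::
  "nat \<Rightarrow> (nat \<Rightarrow> nat \<times> nat) \<Rightarrow> (nat \<Rightarrow> nat) \<Rightarrow> nat \<times> nat" where
  "knapsack_value m u x = (\<Sum>i = 1..m. fst (u i) * x i, \<Sum>i = 1..m. snd (u i) * x i)"

definition efficient_knapsack ::
  "nat \<Rightarrow> (nat \<Rightarrow> nat \<times> nat) \<Rightarrow> (nat \<Rightarrow> nat) \<Rightarrow> nat \<Rightarrow> (nat \<Rightarrow> nat) set" where
  "efficient_knapsack m u c B = efficient_max (knapsack_feasible m c B) (knapsack_value m u)"

text \<open>
  Given an enumeration \<open>e 1, \<dots>, e m\<close> of the arcs, an arc-indexed vector \<open>\<gamma>\<close> is identified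
  with the vector having components \<open>\<gamma> (e i)\<close> for \<open>i = 1, \<dots>, m\<close>.
\<close>

definition index_vector :: "nat \<Rightarrow> (nat \<Rightarrow> 'e) \<Rightarrow> ('e \<Rightarrow> nat) \<Rightarrow> (nat \<Rightarrow> nat)" where
  "index_vector m e \<gamma> = (\<lambda>i \<in> {1..m}. \<gamma> (e i))"

end

theory Submission
  imports Defs
begin

text \<open>
  In a two-terminal parallel graph the arcs do not interact: the flow that saturates every arc
  is maximum, so the maximum flow value is the total capacity. Interdicting \<open>\<gamma>\<close> therefore
  lowers the maximum flow value by exactly the capacity \<open>\<Sum>a. w a * \<gamma> a\<close> of the interdicted
  arcs (\<open>max_flow_value_interdict\<close>), which is the knapsack value of \<open>\<gamma>\<close>.
  Thus each interdiction objective is a constant minus the corresponding knapsack objective.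
  Complementing both components to a constant reverses the dominance order, so minimizing the
  flow values is the same as maximizing the knapsack values; and since both problems have the
  same budget constraint, the efficient solutions agree up to the indexing of the arcs.
\<close>

text \<open>
  Flow conservation is void without inner vertices, and no arc enters \<open>s\<close>,
  so the value of a flow is the sum of its arc values, each bounded by the capacity only.
\<close>

lemma max_flow_value_parallel:
  assumes par: "two_terminal_parallel G s t" and "s \<noteq> t"
  shows "max_flow_value G s t w = real (\<Sum>a \<in> arcs G. w a)"
proof -
  have out: "out_arcs G s = arcs G" and "in": "in_arcs G s = {}"
    using assms by (auto simp: two_terminal_parallel_def out_arcs_def in_arcs_def)
  have val: "flow_value G s f = (\<Sum>a \<in> arcs G. f a)" for f
    by (simp add: flow_value_def out "in")
  have flow: "is_flow G s t w f \<longleftrightarrow> (\<forall>a \<in> arcs G. 0 \<le> f a \<and> f a \<le> real (w a))" for f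
    using par by (simp add: is_flow_def two_terminal_parallel_def)
  show ?thesis
    unfolding max_flow_value_def
  proof (rule Greatest_equality)
    show "\<exists>f. is_flow G s t w f \<and> real (\<Sum>a \<in> arcs G. w a) = flow_value G s f"
      by (rule exI[of _ "\<lambda>a. real (w a)"]) (simp add: flow val)
  next
    fix r assume "\<exists>f. is_flow G s t w f \<and> r = flow_value G s f"
    then show "r \<le> real (\<Sum>a \<in> arcs G. w a)"
      by (auto simp: flow val intro: sum_mono)
  qed
qed

lemma two_terminal_parallel_interdict:
  "two_terminal_parallel G s t \<Longrightarrow> two_terminal_parallel (interdict G \<gamma>) s t"
  by (simp add: two_terminal_parallel_def interdict_def)

lemma max_flow_value_interdict:
  assumes "two_terminal_parallel G s t" and "s \<noteq> t" and fin: "finite (arcs G)"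
    and \<gamma>: "\<gamma> \<in> arcs G \<rightarrow>\<^sub>E {0, 1}"
  shows "max_flow_value (interdict G \<gamma>) s t w
           = real (\<Sum>a \<in> arcs G. w a) - real (\<Sum>a \<in> arcs G. w a * \<gamma> a)"
proof -
  have "(\<Sum>a \<in> arcs G. w a * \<gamma> a) = (\<Sum>a \<in> interdicted_arcs G \<gamma>. w a * \<gamma> a)"
    using fin PiE_mem[OF \<gamma>]
    by (intro sum.mono_neutral_right) (fastforce simp: interdicted_arcs_def)+
  also have "\<dots> = (\<Sum>a \<in> interdicted_arcs G \<gamma>. w a)"
    by (simp add: interdicted_arcs_def)
  finally have "(\<Sum>a \<in> arcs G. w a)
      = (\<Sum>a \<in> arcs (interdict G \<gamma>). w a) + (\<Sum>a \<in> arcs G. w a * \<gamma> a)"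
    using fin sum.subset_diff[of "interdicted_arcs G \<gamma>" "arcs G" w]
    by (simp add: interdict_def interdicted_arcs_def)
  then show ?thesis
    using assms by (simp add: max_flow_value_parallel two_terminal_parallel_interdict)
qed

text \<open>
  Efficiency depends only on the dominance relation between feasible points, so it is transported
  by any parametrization of the feasible set that reverses dominance.
\<close>

lemma efficient_max_image:
  assumes "\<And>x y. x \<in> S \<Longrightarrow> y \<in> S \<Longrightarrow> g (\<phi> x) \<preceq> g (\<phi> y) \<longleftrightarrow> f y \<preceq> f x"
  shows "efficient_max (\<phi> ` S) g = \<phi> ` efficient_min S f"
  using assms by (auto simp: efficient_max_def efficient_min_def)

lemma sum_index_vector:
  assumes "bij_betw a {1..m} A"
  shows "(\<Sum>i = 1..m. w (a i) * index_vector m a \<gamma> i) = (\<Sum>x \<in> A. w x * \<gamma> x)"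
  using sum.reindex_bij_betw[OF assms, of "\<lambda>x. w x * \<gamma> x"] by (simp add: index_vector_def)

lemma knapsack_feasible_eq_image:
  assumes bij: "bij_betw a {1..m} (arcs G)"
  shows "knapsack_feasible m (\<lambda>i. c (a i)) B = index_vector m a ` strategies G c B"
proof
  have "index_vector m a \<gamma> \<in> {1..m} \<rightarrow>\<^sub>E {0, 1}" if "\<gamma> \<in> arcs G \<rightarrow>\<^sub>E {0, 1}" for \<gamma>
    unfolding index_vector_def
    using PiE_mem[OF that] bij_betwE[OF bij] by (subst restrict_PiE_iff) blast
  then show "index_vector m a ` strategies G c B \<subseteq> knapsack_feasible m (\<lambda>i. c (a i)) B"
    unfolding knapsack_feasible_def strategies_def
    by (clarsimp simp: sum_index_vector[OF bij] simp del: One_nat_def)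
next
  show "knapsack_feasible m (\<lambda>i. c (a i)) B \<subseteq> index_vector m a ` strategies G c B"
  proof
    fix x assume x: "x \<in> knapsack_feasible m (\<lambda>i. c (a i)) B"
    define \<gamma> where "\<gamma> = (\<lambda>b \<in> arcs G. x (inv_into {1..m} a b))"
    have "\<gamma> (a i) = x i" if "i \<in> {1..m}" for i
      using that bij bij_betwE[OF bij] by (simp add: \<gamma>_def bij_betw_inv_into_left)
    then have x_eq: "x = index_vector m a \<gamma>"
      using x by (auto simp: knapsack_feasible_def index_vector_def PiE_def extensional_def)
    have "\<gamma> \<in> arcs G \<rightarrow>\<^sub>E {0, 1}"
      using x bij_betwE[OF bij_betw_inv_into[OF bij]]
      unfolding \<gamma>_def knapsack_feasible_def restrict_PiE_iff by blast
    moreover have "(\<Sum>b \<in> arcs G. c b * \<gamma> b) \<le> B"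
      using x sum_index_vector[OF bij, of c \<gamma>] by (simp add: knapsack_feasible_def x_eq)
    ultimately show "x \<in> index_vector m a ` strategies G c B"
      by (auto simp: x_eq strategies_def)
  qed
qed

theorem theorem3:
  fixes G :: "('v, 'e) pre_digraph"
    and s t :: 'v
    and u :: "'e \<Rightarrow> nat \<times> nat"
    and c :: "'e \<Rightarrow> nat"
    and B m :: nat
    and a :: "nat \<Rightarrow> 'e"
  assumes "st_network G s t"
    and "two_terminal_parallel G s t"
    and "bij_betw a {1..m} (arcs G)"
  shows "efficient_knapsack m (\<lambda>i. u (a i)) (\<lambda>i. c (a i)) B
           = index_vector m a ` efficient_strategies G s t u c B"
proof -
  have st: "s \<noteq> t"
    using assms(1) by (rule st_network.source_neq_sink)
  have fin: "finite (arcs G)"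
    using assms(3) bij_betw_finite by blast
  have knapsack: "knapsack_value m (\<lambda>i. u (a i)) (index_vector m a \<gamma>)
      = (\<Sum>b \<in> arcs G. fst (u b) * \<gamma> b, \<Sum>b \<in> arcs G. snd (u b) * \<gamma> b)" for \<gamma>
    using sum_index_vector[OF assms(3), of "\<lambda>b. fst (u b)"]
      sum_index_vector[OF assms(3), of "\<lambda>b. snd (u b)"]
    by (simp add: knapsack_value_def)
  have interdiction: "max_flow_value2 (interdict G \<gamma>) s t u
      = (real (\<Sum>b \<in> arcs G. fst (u b)) - real (\<Sum>b \<in> arcs G. fst (u b) * \<gamma> b),
         real (\<Sum>b \<in> arcs G. snd (u b)) - real (\<Sum>b \<in> arcs G. snd (u b) * \<gamma> b))"
    if "\<gamma> \<in> strategies G c B" for \<gamma>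
    using that max_flow_value_interdict[OF assms(2) st fin, of \<gamma>]
    by (simp add: max_flow_value2_def strategies_def)
  show ?thesis
    unfolding efficient_knapsack_def efficient_strategies_def
      knapsack_feasible_eq_image[OF assms(3)]
  proof (rule efficient_max_image)
    fix \<gamma> \<gamma>' assume "\<gamma> \<in> strategies G c B" and "\<gamma>' \<in> strategies G c B"
    then show "knapsack_value m (\<lambda>i. u (a i)) (index_vector m a \<gamma>)
          \<preceq> knapsack_value m (\<lambda>i. u (a i)) (index_vector m a \<gamma>')
        \<longleftrightarrow> max_flow_value2 (interdict G \<gamma>') s t u \<preceq> max_flow_value2 (interdict G \<gamma>) s t u"
      unfolding knapsack interdiction[OF \<open>\<gamma> \<in> strategies G c B\<close>]
        interdiction[OF \<open>\<gamma>' \<in> strategies G c B\<close>] dom_le_def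
      by (auto simp del: of_nat_sum)
  qed
qed

end
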